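(* Let $k\ge 1$ be an integer, let $u$ be a real-valued function of class $C^{k+1}$ on an open neighborhood of the origin in $\mathbb{R}^2$, and let the radial basis function have the form $\phi(r;c)=f(cr^2)$ with shape parameter $c>0$, where $f\in C^2[0,\infty)$. Fix reference sample points $\mathbf{x}_1,\dots,\mathbf{x}_n\in\mathbb{R}^2$ and reference ghost points $\hat{\mathbf{x}}_1,\dots,\hat{\mathbf{x}}_d\in\mathbb{R}^2$, $d<n$. For $h>0$ use the sample points $h\mathbf{x}_i$, the ghost points $h\hat{\mathbf{x}}_m$, the shape parameter $c=c(h)$ with $ch^2$ equal to a constant independent of $h$, and the polynomial basis consisting of all monomials of degree $1$ up to $k$. Let $\mathbf{w}_A=\mathbf{w}_A(h)\in\mathbb{R}^n$ be the resulting CLS-GSP weights for the Laplacian at the origin, and let $\mathbf{u}_h=\big(u(h\mathbf{x}_1)-u(\mathbf{0}),\dots,u(h\mathbf{x}_n)-u(\mathbf{0})\big)^T$. Assume that the CLS-GSP matrix $M_h$ has full rank $d+l$. Then the approximation $\Delta u(\mathbf{0})\approx \mathbf{w}_A^T\mathbf{u}_h$ is consistent of order $k-1$, i.e. $$\left|\mathbf{w}_A^T\mathbf{u}_h-\Delta u(\mathbf{0})\right|=O(h^{k-1})\quad\text{as } h\to 0^+.$$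
   Context: Setting (dimension 2, center point at the origin). Let $P_1,\dots,P_l$ be the monomials $x^ay^b$ with $1\le a+b\le k$ (the constant is excluded), so $l=\frac12(k+1)(k+2)-1$. For $h>0$, set $$\psi_m(\mathbf{x})=\phi(\|\mathbf{x}-h\hat{\mathbf{x}}_m\|;c)-\phi(\|h\hat{\mathbf{x}}_m\|;c),\qquad m=1,\dots,d,$$ with $\|\cdot\|$ the Euclidean norm, and let $\boldsymbol\Psi$ be the $n\times d$ matrix with entries $\psi_m(h\mathbf{x}_i)$, $\mathbf{P}$ the $n\times l$ matrix with entries $P_j(h\mathbf{x}_i)$, and $\hat{\mathbf{P}}$ the $d\times l$ matrix with entries $P_j(h\hat{\mathbf{x}}_m)$. The CLS-GSP matrix is the $(n+l)\times(d+l)$ matrix $$M_h=\begin{pmatrix}\boldsymbol\Psi & \mathbf{P}\\ \hat{\mathbf{P}}^T & \mathbf{0}\end{pmatrix}.$$ The CLS-GSP weights for the Laplacian at the origin are the vector $\mathbf{w}_A\in\mathbb{R}^n$ of the first $n$ entries of $$\begin{pmatrix}\mathbf{w}_A\\ \mathbf{w}_B\end{pmatrix}=(M_h^T)^\dagger\begin{pmatrix}\Delta\boldsymbol\psi|_{\mathbf{x}=\mathbf{0}}\\ \Delta\mathbf{P}|_{\mathbf{x}=\mathbf{0}}\end{pmatrix}\in\mathbb{R}^{n+l},$$ where $\dagger$ is the Moore–Penrose pseudoinverse, $\Delta\boldsymbol\psi|_{\mathbf{x}=\mathbf{0}}=(\Delta\psi_1(\mathbf{0}),\dots,\Delta\psi_d(\mathbf{0}))^T$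 and $\Delta\mathbf{P}|_{\mathbf{x}=\mathbf{0}}=(\Delta P_1(\mathbf{0}),\dots,\Delta P_l(\mathbf{0}))^T$. All quantities depend on $h$. An estimation $\theta_h$ of a quantity $\theta$ is consistent of order $p$ if $|\theta_h-\theta|=O(h^p)$ as $h\to0$. *)

theory Defs
  imports
    "HOL-Analysis.Analysis"
    "HOL-Library.Landau_Symbols"
    "Jordan_Normal_Form.DL_Rank"
begin

no_notation Matrix.vec_index (infixl \<open>$\<close> 100)
no_notation inner (infix \<open>\<bullet>\<close> 70)
hide_const (open) Finite_Cartesian_Product.vec Finite_Cartesian_Product.mat
hide_type (open) Finite_Cartesian_Product.vec

definition partial_deriv :: "2 \<Rightarrow> (real^2 \<Rightarrow> real) \<Rightarrow> real^2 \<Rightarrow> real" where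
  "partial_deriv i g x = deriv (\<lambda>t. g (x + t *\<^sub>R axis i 1)) 0"

definition laplacian :: "(real^2 \<Rightarrow> real) \<Rightarrow> real^2 \<Rightarrow> real" where
  "laplacian g x = (\<Sum>i\<in>UNIV. partial_deriv i (partial_deriv i g) x)"

text \<open>\<^term>\<open>C_on m g S\<close>: the function \<^term>\<open>g\<close> is of class $C^m$ on the set \<^term>\<open>S\<close>,
  which is meant to be open.\<close>

primrec C_on :: "nat \<Rightarrow> (real^2 \<Rightarrow> real) \<Rightarrow> (real^2) set \<Rightarrow> bool" where
  "C_on 0 g S \<longleftrightarrow> continuous_on S g"
| "C_on (Suc m) g S \<longleftrightarrow>
     (\<forall>x\<in>S. g differentiable (at x)) \<and> (\<forall>i. C_on m (partial_deriv i g) S)"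

text \<open>Class $C^2$ on $[0,\infty)$, with one-sided derivatives at $0$.\<close>

definition C2_nonneg :: "(real \<Rightarrow> real) \<Rightarrow> bool" where
  "C2_nonneg f \<longleftrightarrow> (\<exists>f' f''.
     (\<forall>t\<ge>0. (f has_real_derivative f' t) (at t within {0..})) \<and>
     (\<forall>t\<ge>0. (f' has_real_derivative f'' t) (at t within {0..})) \<and>
     continuous_on {0..} f'')"

definition is_pinv :: "real mat \<Rightarrow> real mat \<Rightarrow> bool" where
  "is_pinv A B \<longleftrightarrow> B \<in> carrier_mat (dim_col A) (dim_row A) \<and>
     A * B * A = A \<and> B * A * B = B \<and>
     (A * B)\<^sup>T = A * B \<and> (B * A)\<^sup>T = B * A"

definition pinv :: "real mat \<Rightarrow> real mat" where
  "pinv A = (THE B. is_pinv A B)"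

lemma is_pinv_unique:
  assumes B: "is_pinv A B" and C: "is_pinv A C"
  shows "B = C"
proof -
  define n m where nm: "n = dim_row A" "m = dim_col A"
  have cA: "A \<in> carrier_mat n m" and cB: "B \<in> carrier_mat m n" and cC: "C \<in> carrier_mat m n"
    using B C by (auto simp: is_pinv_def nm)
  note b = B[unfolded is_pinv_def] and c = C[unfolded is_pinv_def]
  have cT: "A\<^sup>T \<in> carrier_mat m n" "B\<^sup>T \<in> carrier_mat n m" "C\<^sup>T \<in> carrier_mat n m"
    using cA cB cC by auto
  have "A * B = (A * C * A) * B" using c by simp
  also have "\<dots> = (A * C) * (A * B)"
    using cA cB cC by (intro assoc_mult_mat[of _ n n _ m _ n]) auto
  also have "\<dots> = (A * C)\<^sup>T * (A * B)\<^sup>T" using b c by simp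
  also have "\<dots> = ((A * B) * (A * C))\<^sup>T"
    using cA cB cC by (subst transpose_mult[of _ n n _ n]) auto
  also have "(A * B) * (A * C) = (A * B * A) * C"
    using cA cB cC by (intro assoc_mult_mat[of _ n n _ m _ n, symmetric]) auto
  also have "\<dots>\<^sup>T = A * C" using b c by simp
  finally have 1: "A * B = A * C" .
  have "B * A = B * (A * C * A)" using c by simp
  also have "\<dots> = B * (A * (C * A))"
    using cA cB cC by (subst assoc_mult_mat[of A n m C n A m]) auto
  also have "\<dots> = (B * A) * (C * A)"
    using cA cB cC by (intro assoc_mult_mat[of _ m n _ m _ m, symmetric]) auto
  also have "\<dots> = (B * A)\<^sup>T * (C * A)\<^sup>T" using b c by simp
  also have "\<dots> = ((C * A) * (B * A))\<^sup>T"
    using cA cB cC by (subst transpose_mult[of _ m m _ m]) auto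
  also have "(C * A) * (B * A) = C * (A * (B * A))"
    using cA cB cC by (intro assoc_mult_mat[of _ m n _ m _ m]) auto
  also have "A * (B * A) = A * B * A"
    using cA cB cC by (intro assoc_mult_mat[of _ n m _ n _ m, symmetric]) auto
  also have "(C * (A * B * A))\<^sup>T = C * A" using b c by simp
  finally have 2: "B * A = C * A" .
  have "B = B * A * B" using b by simp
  also have "\<dots> = C * A * B" using 2 by simp
  also have "\<dots> = C * (A * B)"
    using cA cB cC by (intro assoc_mult_mat[of _ m n _ m _ n]) auto
  also have "\<dots> = C * (A * C)" using 1 by simp
  also have "\<dots> = C * A * C"
    using cA cB cC by (intro assoc_mult_mat[of _ m n _ m _ n, symmetric]) auto
  also have "\<dots> = C" using c by simp
  finally show ?thesis .
qed

definition exponents :: "nat \<Rightarrow> (nat \<times> nat) set" where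
  "exponents k = {(a, b). 1 \<le> a + b \<and> a + b \<le> k}"

definition num_monomials :: "nat \<Rightarrow> nat" where
  "num_monomials k = (k + 1) * (k + 2) div 2 - 1"

lemma card_exponents: "finite (exponents k)" "card (exponents k) = num_monomials k"
proof -
  have "finite (exponents k) \<and> card (exponents k) = num_monomials k"
  proof (induction k)
    case 0
    have "exponents 0 = {}" by (auto simp: exponents_def)
    then show ?case by (simp add: num_monomials_def)
  next
    case (Suc k)
    let ?D = "(\<lambda>a. (a, Suc k - a)) ` {..Suc k}"
    have eq: "exponents (Suc k) = exponents k \<union> ?D"
      by (auto simp: exponents_def image_iff)
    have "exponents k \<inter> ?D = {}" by (auto simp: exponents_def)
    moreover have "card ?D = k + 2" by (subst card_image) (auto simp: inj_on_def)
    moreover have "(Suc k + 1) * (Suc k + 2) = (k + 1) * (k + 2) + 2 * (k + 2)"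
      by (simp add: algebra_simps)
    ultimately show ?case
      using Suc unfolding eq by (simp add: card_Un_disjoint num_monomials_def)
  qed
  then show "finite (exponents k)" "card (exponents k) = num_monomials k" by auto
qed

definition monomial :: "nat \<times> nat \<Rightarrow> real^2 \<Rightarrow> real" where
  "monomial e x = (x $ 1) ^ fst e * (x $ 2) ^ snd e"

text \<open>In the definitions below, \<^term>\<open>c\<close> is the shape parameter at the given scale \<^term>\<open>h\<close>, the
  reference points are \<^term>\<open>xs i\<close> for \<^term>\<open>i < n\<close> and \<^term>\<open>gs m\<close> for \<^term>\<open>m < d\<close>, and
  \<^term>\<open>E\<close> lists the exponents of the polynomial basis in some order.\<close>

definition psi :: "(real \<Rightarrow> real \<Rightarrow> real) \<Rightarrow> real \<Rightarrow> real \<Rightarrow> (nat \<Rightarrow> real^2) \<Rightarrow> nat \<Rightarrow> real^2 \<Rightarrow> real" where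
  "psi \<phi> c h gs m x = \<phi> (norm (x - h *\<^sub>R gs m)) c - \<phi> (norm (h *\<^sub>R gs m)) c"

definition cls_gsp_matrix ::
  "(real \<Rightarrow> real \<Rightarrow> real) \<Rightarrow> nat \<Rightarrow> (nat \<Rightarrow> nat \<times> nat) \<Rightarrow> nat \<Rightarrow> (nat \<Rightarrow> real^2) \<Rightarrow>
   nat \<Rightarrow> (nat \<Rightarrow> real^2) \<Rightarrow> real \<Rightarrow> real \<Rightarrow> real mat" where
  "cls_gsp_matrix \<phi> k E n xs d gs c h =
     (let l = num_monomials k;
          \<Psi> = mat n d (\<lambda>(i, m). psi \<phi> c h gs m (h *\<^sub>R xs i));
          P = mat n l (\<lambda>(i, j). monomial (E j) (h *\<^sub>R xs i));
          P' = mat d l (\<lambda>(m, j). monomial (E j) (h *\<^sub>R gs m))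
      in four_block_mat \<Psi> P (P'\<^sup>T) (0\<^sub>m l l))"

definition cls_gsp_rhs ::
  "(real \<Rightarrow> real \<Rightarrow> real) \<Rightarrow> nat \<Rightarrow> (nat \<Rightarrow> nat \<times> nat) \<Rightarrow>
   nat \<Rightarrow> (nat \<Rightarrow> real^2) \<Rightarrow> real \<Rightarrow> real \<Rightarrow> real vec" where
  "cls_gsp_rhs \<phi> k E d gs c h =
     vec d (\<lambda>m. laplacian (psi \<phi> c h gs m) 0) @\<^sub>v
     vec (num_monomials k) (\<lambda>j. laplacian (monomial (E j)) 0)"

definition cls_gsp_weights ::
  "(real \<Rightarrow> real \<Rightarrow> real) \<Rightarrow> nat \<Rightarrow> (nat \<Rightarrow> nat \<times> nat) \<Rightarrow> nat \<Rightarrow> (nat \<Rightarrow> real^2) \<Rightarrow>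
   nat \<Rightarrow> (nat \<Rightarrow> real^2) \<Rightarrow> real \<Rightarrow> real \<Rightarrow> real vec" where
  "cls_gsp_weights \<phi> k E n xs d gs c h =
     vec_first (pinv ((cls_gsp_matrix \<phi> k E n xs d gs c h)\<^sup>T) *\<^sub>v cls_gsp_rhs \<phi> k E d gs c h) n"

end

theory Submission
  imports Defs
begin

text \<open>The rule is exact on the monomials of degree 1 to $k$, because full rank lets the pseudoinverse solve
$M_h^Tw=b_h$ exactly and the polynomial equations of that system involve $w_A$ alone
(\<open>cls_gsp_weights_exact_on_monomials\<close>). Hence it treats the Taylor polynomial of $u$ of degree $k$
correctly if $k\ge 2$, and for $k=1$ with an error that does not depend on $h$
(\<open>laplacian_exact_quadrature_taylor\<close>). What is left is the sum of the weights times Taylor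
remainders of size $O(h^{k+1})$ (\<open>taylor_remainder_along_ray\<close>), so everything depends on the
weights being $O(h^{-2})$ (\<open>cls_gsp_weights_bound\<close>).

Since $ch^2$ is constant, passing from scale 1 to scale $h$ multiplies the rows and columns of the
matrix by powers of $h$, and the right-hand side by the column factors and by $h^{-2}$. This does not
give the bound at once: the pseudoinverse picks the solution of least norm, and the least-norm
condition is not invariant under a row scaling. In the variables of the system at scale 1 it becomes
a least-norm condition with weights that degenerate as $h\to 0$ at different rates. The bound therefore
comes from the theorem of Stewart and Todd that, for a fixed system, the weighted least-norm
solutions are bounded uniformly over all positive weights
(\<open>weighted_orthogonal_solutions_bounded\<close>).\<close>

section \<open>Pseudoinverses of full-rank matrices\<close>

lemma full_column_rank_imp_inj:
  fixes M :: "real mat"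
  assumes M: "M \<in> carrier_mat r s" and rank: "vec_space.rank r M = s"
    and v: "v \<in> carrier_vec s" and Mv: "M *\<^sub>v v = 0\<^sub>v r"
  shows "v = 0\<^sub>v s"
proof (rule ccontr)
  assume v0: "v \<noteq> 0\<^sub>v s"
  interpret vec_space "TYPE(real)" r .
  (* The rank is computed from the set of columns, so a repeated column already lowers it. *)
  have "vec_space.rank r M \<le> card (set (cols M))"
  proof -
    obtain S where S: "maximal S (\<lambda>T. T \<subseteq> set (cols M) \<and> lin_indpt T)"
      using maximal_exists[of "(\<lambda>T. T \<subseteq> set (cols M) \<and> lin_indpt T)" "card (set (cols M))" "{}"]
      by (meson List.finite_set card_mono empty_iff empty_subsetI finite_lin_indpt2 rev_finite_subset)
    then show ?thesis
      using rank_card_indpt[OF M S] by (simp add: card_mono maximal_def)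
  qed
  then have "card (set (cols M)) = length (cols M)"
    using M rank card_length[of "cols M"] by auto
  then have dist: "distinct (cols M)" by (rule card_distinct)
  show False
    using lin_depI[OF M v v0 Mv dist] full_rank_lin_indpt[OF M rank dist] by blast
qed

text \<open>If $M^TMv=0$ then $\|Mv\|^2=0$, and full column rank forces $v=0$.\<close>

lemma gram_matrix_invertible:
  fixes M :: "real mat"
  assumes M: "M \<in> carrier_mat r s" and rank: "vec_space.rank r M = s"
  obtains G where "G \<in> carrier_mat s s" "G\<^sup>T = G" "(M\<^sup>T * M) * G = 1\<^sub>m s"
proof -
  let ?N = "M\<^sup>T * M"
  have N: "?N \<in> carrier_mat s s" using M by simp
  have NT: "?N\<^sup>T = ?N" using M by (simp add: transpose_mult[of _ s r _ s])
  have "det ?N \<noteq> 0"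
  proof
    assume "det ?N = 0"
    then obtain v where v: "v \<in> carrier_vec s" "v \<noteq> 0\<^sub>v s" "?N *\<^sub>v v = 0\<^sub>v s"
      using det_0_iff_vec_prod_zero_field[OF N] by blast
    have Mv: "M *\<^sub>v v \<in> carrier_vec r" using M v by simp
    have "M\<^sup>T *\<^sub>v (M *\<^sub>v v) = 0\<^sub>v s"
      using v M by (metis assoc_mult_mat_vec transpose_carrier_mat)
    then have "(M *\<^sub>v v) \<bullet> (M *\<^sub>v v) = 0"
      using transpose_vec_mult_scalar[OF M v(1) Mv] v(1) by simp
    then have "M *\<^sub>v v = 0\<^sub>v r"
      using conjugate_square_eq_0_vec[OF Mv] by simp
    then show False
      using full_column_rank_imp_inj[OF M rank v(1)] v(2) by blast
  qed
  from det_non_zero_imp_unit[OF N this, of undefined]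
  obtain G where G: "G \<in> carrier_mat s s" "G * ?N = 1\<^sub>m s" "?N * G = 1\<^sub>m s"
    unfolding Units_def ring_mat_simps by auto
  have "G\<^sup>T * ?N = 1\<^sub>m s"
    using arg_cong[OF G(3), of "transpose_mat"] N G(1) NT
    by (simp add: transpose_mult[of _ s s _ s])
  then have "(G\<^sup>T * ?N) * G = G" using G(1) by simp
  moreover have "(G\<^sup>T * ?N) * G = G\<^sup>T"
    using G N by (simp add: assoc_mult_mat[of _ s s _ s _ s])
  ultimately have "G\<^sup>T = G" by simp
  then show thesis using that G by blast
qed

text \<open>The definite description in the definition of the pseudoinverse denotes something only once a
pseudoinverse is exhibited; for $M^T$ of full row rank it is $M(M^TM)^{-1}$.\<close>

lemma pinv_transpose_full_column_rank:
  fixes M :: "real mat"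
  assumes M: "M \<in> carrier_mat r s" and rank: "vec_space.rank r M = s"
  obtains G where "G \<in> carrier_mat s s" "(M\<^sup>T * M) * G = 1\<^sub>m s" "pinv (M\<^sup>T) = M * G"
proof -
  obtain G where G: "G \<in> carrier_mat s s" "G\<^sup>T = G" "(M\<^sup>T * M) * G = 1\<^sub>m s"
    using gram_matrix_invertible[OF M rank] .
  have MT: "M\<^sup>T \<in> carrier_mat s r" using M by simp
  have right: "M\<^sup>T * (M * G) = 1\<^sub>m s"
    using G(3) assoc_mult_mat[OF MT M G(1)] by simp
  have "is_pinv (M\<^sup>T) (M * G)"
    unfolding is_pinv_def
  proof (intro conjI)
    show "M * G \<in> carrier_mat (dim_col M\<^sup>T) (dim_row M\<^sup>T)" using M G by simp
    show "M\<^sup>T * (M * G) * M\<^sup>T = M\<^sup>T" using right MT by simp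
    show "M * G * M\<^sup>T * (M * G) = M * G"
      using right M G assoc_mult_mat[of "M * G" r s "M\<^sup>T" r "M * G" s] by simp
    show "(M\<^sup>T * (M * G))\<^sup>T = M\<^sup>T * (M * G)" using right by simp
    have "(M * G * M\<^sup>T)\<^sup>T = M * (M * G)\<^sup>T"
      using M G MT by (subst transpose_mult[of _ r s _ r]) auto
    also have "(M * G)\<^sup>T = G * M\<^sup>T"
      using M G by (subst transpose_mult[of _ r s _ s]) auto
    also have "M * (G * M\<^sup>T) = M * G * M\<^sup>T"
      using M G MT by (simp add: assoc_mult_mat[of _ r s _ s _ r])
    finally show "(M * G * M\<^sup>T)\<^sup>T = M * G * M\<^sup>T" .
  qed
  then have "pinv (M\<^sup>T) = M * G"
    unfolding pinv_def using is_pinv_unique by (intro the_equality) auto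
  then show thesis using that G by blast
qed

text \<open>The two properties of the pseudoinverse solution that matter here: it solves the system exactly, since
$M^T$ has a right inverse, and it lies in the column space of $M$, hence is orthogonal to the
kernel of $M^T$. They are stated with coordinate sums so that the weighted systems obtained by
rescaling can be read off from them.\<close>

lemma pinv_transpose_solves:
  fixes M :: "real mat"
  assumes M: "M \<in> carrier_mat r s" and rank: "vec_space.rank r M = s" and b: "b \<in> carrier_vec s"
  defines "w \<equiv> pinv (M\<^sup>T) *\<^sub>v b"
  shows "w \<in> carrier_vec r"
    and "\<And>j. j < s \<Longrightarrow> (\<Sum>i<r. M $$ (i, j) * vec_index w i) = vec_index b j"
    and "\<And>z. (\<And>j. j < s \<Longrightarrow> (\<Sum>i<r. M $$ (i, j) * z i) = 0) \<Longrightarrow> (\<Sum>i<r. vec_index w i * z i) = 0"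
proof -
  obtain G where G: "G \<in> carrier_mat s s" "(M\<^sup>T * M) * G = 1\<^sub>m s" "pinv (M\<^sup>T) = M * G"
    using pinv_transpose_full_column_rank[OF M rank] .
  define y where "y = G *\<^sub>v b"
  have y: "y \<in> carrier_vec s" using G b by (simp add: y_def)
  have w: "w = M *\<^sub>v y" using G M b by (simp add: w_def y_def)
  show wc: "w \<in> carrier_vec r" using w M y by simp
  have MT: "M\<^sup>T \<in> carrier_mat s r" using M by simp
  have "M\<^sup>T *\<^sub>v w = (M\<^sup>T * M) *\<^sub>v y" using w M MT y by simp
  also have "\<dots> = ((M\<^sup>T * M) * G) *\<^sub>v b"
    unfolding y_def using M MT G b by (subst assoc_mult_mat_vec[of _ s s _ s]) auto
  also have "\<dots> = b" using G b by simp
  finally have eq: "M\<^sup>T *\<^sub>v w = b" .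
  show "(\<Sum>i<r. M $$ (i, j) * vec_index w i) = vec_index b j" if "j < s" for j
    using arg_cong[OF eq, of "\<lambda>v. vec_index v j"] that M wc
    by (auto simp: scalar_prod_def atLeast0LessThan)
  show "(\<Sum>i<r. vec_index w i * z i) = 0"
    if z: "\<And>j. j < s \<Longrightarrow> (\<Sum>i<r. M $$ (i, j) * z i) = 0" for z
  proof -
    have "(\<Sum>i<r. vec_index w i * z i) = (\<Sum>i<r. (\<Sum>j<s. M $$ (i, j) * vec_index y j) * z i)"
      unfolding w using M y by (intro sum.cong) (auto simp: scalar_prod_def atLeast0LessThan)
    also have "\<dots> = (\<Sum>j<s. vec_index y j * (\<Sum>i<r. M $$ (i, j) * z i))"
      unfolding sum_distrib_left sum_distrib_right
      by (subst sum.swap) (simp add: mult_ac)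
    also have "\<dots> = 0" using z by simp
    finally show ?thesis .
  qed
qed

section \<open>Weighted least-norm solutions\<close>

text \<open>A vector with this property is the point nearest to the origin, in the norm with squared weights
$\delta_i$, on the solution set of the linear system through it. The weights are quantified
existentially, so that a statement about all such vectors is uniform in the weights.\<close>

definition weighted_orthogonal :: "'i set \<Rightarrow> 'r set \<Rightarrow> ('r \<Rightarrow> 'i \<Rightarrow> real) \<Rightarrow> ('i \<Rightarrow> real) \<Rightarrow> bool" where
  "weighted_orthogonal I R A x \<longleftrightarrow> (\<exists>\<delta>. (\<forall>i\<in>I. \<delta> i > 0) \<and>
     (\<forall>z. (\<forall>r\<in>R. (\<Sum>i\<in>I. A r i * z i) = 0) \<longrightarrow> (\<Sum>i\<in>I. \<delta> i * (x i * z i)) = 0))"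

text \<open>The bound of Stewart and Todd on weighted least-squares solutions: it does not depend on the weights,
which may degenerate arbitrarily. The reason is a matter of signs. If such solutions were unbounded,
their directions would accumulate at a kernel vector that has the same signs as one of them wherever
it does not vanish, and no positive weights make two vectors of matching signs orthogonal.\<close>

lemma weighted_orthogonal_solutions_bounded:
  fixes A :: "'r \<Rightarrow> 'i \<Rightarrow> real" and b :: "'r \<Rightarrow> real"
  assumes I: "finite I"
  shows "\<exists>C. \<forall>x. (\<forall>r\<in>R. (\<Sum>i\<in>I. A r i * x i) = b r) \<and> weighted_orthogonal I R A x \<longrightarrow>
    (\<forall>i\<in>I. \<bar>x i\<bar> \<le> C)"
proof -
  define S where "S = {x. (\<forall>r\<in>R. (\<Sum>i\<in>I. A r i * x i) = b r) \<and> weighted_orthogonal I R A x}"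
  have "\<exists>C. \<forall>x\<in>S. (\<Sum>i\<in>I. \<bar>x i\<bar>) \<le> C"
  proof (rule ccontr)
    assume "\<not> ?thesis"
    then have "\<forall>j. \<exists>x\<in>S. (\<Sum>i\<in>I. \<bar>x i\<bar>) > real (Suc j)" by (meson not_le)
    then obtain X where X: "\<And>j. X j \<in> S" and large: "\<And>j. (\<Sum>i\<in>I. \<bar>X j i\<bar>) > real (Suc j)"
      by metis
    (* Normalised, a sequence of ever larger members of S subconverges to a unit vector z in the
       kernel of A, because the fixed right-hand side is divided by norms tending to infinity. *)
    define N where "N j = (\<Sum>i\<in>I. \<bar>X j i\<bar>)" for j
    define Y where "Y j i = X j i / N j" for j i
    have N: "N j > real (Suc j)" for j using large by (simp add: N_def)
    have Npos: "N j > 0" for j using N[of j] by simp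
    have Y1: "(\<Sum>i\<in>I. \<bar>Y j i\<bar>) = 1" for j
    proof -
      have "(\<Sum>i\<in>I. \<bar>Y j i\<bar>) = N j / N j"
        using Npos[of j] by (simp add: Y_def N_def abs_divide flip: sum_divide_distrib)
      then show ?thesis using Npos[of j] by simp
    qed
    have Ybd: "\<bar>Y j i\<bar> \<le> 1" if "i \<in> I" for i j
      using member_le_sum[of i I "\<lambda>i. \<bar>Y j i\<bar>"] that I Y1[of j] by simp
    have "\<forall>J\<subseteq>I. \<exists>l r. strict_mono r \<and>
        (\<forall>\<epsilon>>0. eventually (\<lambda>j. \<forall>i\<in>J. dist (Y (r j) i) (l i) < \<epsilon>) sequentially)"
      by (rule compact_lemma_general[where unproj = "\<lambda>e. e" and proj = "\<lambda>x i. x i", OF I])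
         (auto simp: bounded_iff intro!: exI[of _ 1] Ybd)
    then obtain z r where r: "strict_mono r" and
      conv: "\<And>\<epsilon>. \<epsilon> > 0 \<Longrightarrow> eventually (\<lambda>j. \<forall>i\<in>I. dist (Y (r j) i) (z i) < \<epsilon>) sequentially"
      by blast
    have lim: "(\<lambda>j. Y (r j) i) \<longlonglongrightarrow> z i" if "i \<in> I" for i
      unfolding tendsto_iff
    proof (intro allI impI)
      fix e :: real assume "e > 0"
      from conv[OF this] show "\<forall>\<^sub>F j in sequentially. dist (Y (r j) i) (z i) < e"
        by (rule eventually_mono) (use that in blast)
    qed
    have "(\<lambda>j. \<Sum>i\<in>I. \<bar>Y (r j) i\<bar>) \<longlonglongrightarrow> (\<Sum>i\<in>I. \<bar>z i\<bar>)"
      by (intro tendsto_intros lim)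
    then have z1: "(\<Sum>i\<in>I. \<bar>z i\<bar>) = 1" by (simp add: Y1 LIMSEQ_const_iff)
    have ker: "(\<Sum>i\<in>I. A q i * z i) = 0" if q: "q \<in> R" for q
    proof -
      have "(\<lambda>j. \<Sum>i\<in>I. A q i * Y (r j) i) \<longlonglongrightarrow> (\<Sum>i\<in>I. A q i * z i)"
        by (intro tendsto_intros lim)
      moreover have "(\<lambda>j. \<Sum>i\<in>I. A q i * Y (r j) i) = (\<lambda>j. b q * inverse (N (r j)))"
      proof
        fix j
        have "(\<Sum>i\<in>I. A q i * Y (r j) i) = (\<Sum>i\<in>I. A q i * X (r j) i) * inverse (N (r j))"
          by (simp add: Y_def divide_inverse sum_distrib_right mult.assoc)
        then show "(\<Sum>i\<in>I. A q i * Y (r j) i) = b q * inverse (N (r j))"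
          using X[of "r j"] q by (simp add: S_def)
      qed
      moreover have "(\<lambda>j. b q * inverse (N (r j))) \<longlonglongrightarrow> b q * 0"
      proof (intro tendsto_intros)
        have "filterlim (\<lambda>j. N j) at_top sequentially"
        proof (rule filterlim_at_top_mono[OF filterlim_real_sequentially])
          show "\<forall>\<^sub>F j in sequentially. real j \<le> N j"
            using N by (intro always_eventually) (smt (verit) of_nat_Suc)
        qed
        then have "filterlim (\<lambda>j. N (r j)) at_top sequentially"
          by (rule filterlim_compose) (rule filterlim_subseq[OF r])
        then show "(\<lambda>j. inverse (N (r j))) \<longlonglongrightarrow> 0"
          by (rule tendsto_inverse_0_at_top)
      qed
      ultimately show ?thesis by (metis LIMSEQ_unique mult_zero_right)
    qed
    (* Far along the sequence the normalised vectors share the signs of z on the support of z, so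
       all terms of the weighted inner product with z are nonnegative and those on the support
       of z are positive, whatever the weights: they cannot sum to 0. *)
    have "eventually (\<lambda>j. \<forall>i\<in>I. z i \<noteq> 0 \<longrightarrow> Y (r j) i * z i > 0) sequentially"
    proof (intro eventually_ball_finite[OF I] ballI)
      fix i assume i: "i \<in> I"
      show "eventually (\<lambda>j. z i \<noteq> 0 \<longrightarrow> Y (r j) i * z i > 0) sequentially"
      proof (cases "z i = 0")
        case False
        have "(\<lambda>j. Y (r j) i * z i) \<longlonglongrightarrow> z i * z i" by (intro tendsto_intros lim i)
        moreover have "z i * z i > 0" using False by (metis not_real_square_gt_zero)
        ultimately show ?thesis by (auto dest: order_tendstoD elim!: eventually_mono)
      qed simp
    qed
    then obtain j where j: "\<And>i. i \<in> I \<Longrightarrow> z i \<noteq> 0 \<Longrightarrow> Y (r j) i * z i > 0"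
      using eventually_happens'[OF sequentially_bot] by blast
    obtain \<delta> where \<delta>: "\<And>i. i \<in> I \<Longrightarrow> \<delta> i > 0" and orth: "(\<Sum>i\<in>I. \<delta> i * (X (r j) i * z i)) = 0"
      using X[of "r j"] ker unfolding S_def weighted_orthogonal_def by blast
    have XY: "X (r j) i = N (r j) * Y (r j) i" for i using Npos[of "r j"] by (simp add: Y_def)
    have pos: "\<delta> i * (X (r j) i * z i) > 0" if "i \<in> I" "z i \<noteq> 0" for i
      using j[OF that] \<delta>[OF that(1)] Npos[of "r j"] by (simp add: XY mult.assoc)
    have nonneg: "\<delta> i * (X (r j) i * z i) \<ge> 0" if "i \<in> I" for i
      using pos[OF that] by (cases "z i = 0") auto
    have "\<forall>i\<in>I. \<delta> i * (X (r j) i * z i) = 0"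
      using orth sum_nonneg_eq_0_iff[OF I, of "\<lambda>i. \<delta> i * (X (r j) i * z i)"] nonneg by blast
    then have "\<forall>i\<in>I. z i = 0" using pos by force
    then show False using z1 by simp
  qed
  then obtain C where C: "\<And>x. x \<in> S \<Longrightarrow> (\<Sum>i\<in>I. \<bar>x i\<bar>) \<le> C" by blast
  show ?thesis
  proof (intro exI[of _ C] allI impI ballI)
    fix x i
    assume "(\<forall>r\<in>R. (\<Sum>i\<in>I. A r i * x i) = b r) \<and> weighted_orthogonal I R A x" and i: "i \<in> I"
    then have "x \<in> S" unfolding S_def by blast
    moreover have "\<bar>x i\<bar> \<le> (\<Sum>i\<in>I. \<bar>x i\<bar>)"
      using i I by (intro member_le_sum) auto
    ultimately show "\<bar>x i\<bar> \<le> C" using C by force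
  qed
qed

section \<open>Taylor expansion along rays\<close>

text \<open>The $m$-th derivative of $t\mapsto g(tx)$ is \<open>dirderiv x m g\<close> at the point $tx$. It is
expanded over all words of $m$ coordinate directions, with mixed partials taken in the order of the word.\<close>

primrec dirderiv :: "real^2 \<Rightarrow> nat \<Rightarrow> (real^2 \<Rightarrow> real) \<Rightarrow> real^2 \<Rightarrow> real" where
  "dirderiv x 0 g y = g y"
| "dirderiv x (Suc m) g y = (\<Sum>i\<in>UNIV. x $ i * dirderiv x m (partial_deriv i g) y)"

lemma has_derivative_along_line:
  assumes "g differentiable (at (t *\<^sub>R x))"
  shows "((\<lambda>t. g (t *\<^sub>R x)) has_real_derivative (\<Sum>i\<in>UNIV. x $ i * partial_deriv i g (t *\<^sub>R x))) (at t)"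
proof -
  let ?y = "t *\<^sub>R x"
  obtain g' where g': "(g has_derivative g') (at ?y)"
    using assms by (auto simp: differentiable_def)
  then have lin: "linear g'" by (rule has_derivative_linear)
  have partial: "partial_deriv i g ?y = g' (axis i 1)" for i
  proof -
    have "((\<lambda>s. g (?y + s *\<^sub>R axis i 1)) has_derivative (\<lambda>s. g' (s *\<^sub>R axis i 1))) (at 0)"
      using g' by (auto intro!: has_derivative_compose[where f = "\<lambda>s. ?y + s *\<^sub>R axis i 1" and g = g] derivative_eq_intros)
    then have "((\<lambda>s. g (?y + s *\<^sub>R axis i 1)) has_real_derivative g' (axis i 1)) (at 0)"
      by (simp add: has_field_derivative_def linear_scale[OF lin] mult.commute[of _ "g' (axis i 1)"])
    then show ?thesis by (simp add: partial_deriv_def DERIV_imp_deriv)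
  qed
  have "g' x = g' (\<Sum>i\<in>UNIV. x $ i *\<^sub>R axis i 1)"
    using basis_expansion[of x] by (simp add: scalar_mult_eq_scaleR)
  also have "\<dots> = (\<Sum>i\<in>UNIV. x $ i * partial_deriv i g ?y)"
    by (simp add: linear_sum[OF lin] linear_scale[OF lin] partial)
  finally have g'x: "g' x = (\<Sum>i\<in>UNIV. x $ i * partial_deriv i g ?y)" .
  have "((\<lambda>t. g (t *\<^sub>R x)) has_derivative (\<lambda>s. g' (s *\<^sub>R x))) (at t)"
    using g' by (auto intro!: has_derivative_compose[where f = "\<lambda>t. t *\<^sub>R x" and g = g] derivative_eq_intros)
  then show ?thesis
    by (simp add: has_field_derivative_def linear_scale[OF lin] g'x mult.commute[of _ "sum _ _"])
qed

lemma dirderiv_has_derivative_along_line: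
  assumes "C_on (Suc m) g S" "t *\<^sub>R x \<in> S"
  shows "((\<lambda>t. dirderiv x m g (t *\<^sub>R x)) has_real_derivative dirderiv x (Suc m) g (t *\<^sub>R x)) (at t)"
  using assms
proof (induction m arbitrary: g)
  case 0
  then show ?case using has_derivative_along_line[of g t x] by auto
next
  case (Suc m)
  have "((\<lambda>t. dirderiv x m (partial_deriv i g) (t *\<^sub>R x)) has_real_derivative
      dirderiv x (Suc m) (partial_deriv i g) (t *\<^sub>R x)) (at t)" for i
    using Suc.prems by (intro Suc.IH) auto
  then show ?case
    unfolding dirderiv.simps(2)[of x m g] dirderiv.simps(2)[of x "Suc m" g]
    by (intro DERIV_sum DERIV_cmult)
qed

lemma dirderiv_continuous_on: "C_on m g S \<Longrightarrow> continuous_on S (dirderiv x m g)"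
proof (induction m arbitrary: g)
  case 0
  have "dirderiv x 0 g = g" by (rule ext) simp
  then show ?case using 0 by simp
next
  case (Suc m)
  have "dirderiv x (Suc m) g = (\<lambda>y. \<Sum>i\<in>UNIV. x $ i * dirderiv x m (partial_deriv i g) y)"
    by (rule ext) simp
  then show ?case using Suc by (auto intro!: continuous_intros)
qed

lemma C_on_mono: "C_on m g S \<Longrightarrow> j \<le> m \<Longrightarrow> open S \<Longrightarrow> C_on j g S"
proof (induction m arbitrary: j g)
  case (Suc m)
  show ?case
  proof (cases j)
    case 0
    have "continuous_on S g"
      using Suc.prems by (auto intro!: continuous_at_imp_continuous_on differentiable_imp_continuous_within)
    then show ?thesis using 0 by simp
  next
    case (Suc j')
    then show ?thesis using Suc.prems Suc.IH by auto
  qed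
qed auto

text \<open>Viewed as functions of the direction, the terms of the Taylor expansion are homogeneous polynomials,
which is what a quadrature rule that is exact on monomials can act on.\<close>

lemma dirderiv_homogeneous_polynomial:
  "\<exists>q. \<forall>x. dirderiv x m g y = (\<Sum>a\<le>m. q a * monomial (a, m - a) x)"
proof (induction m arbitrary: g)
  case 0
  show ?case by (rule exI[of _ "\<lambda>_. g y"]) (simp add: monomial_def)
next
  case (Suc m)
  obtain q1 where q1: "\<And>x. dirderiv x m (partial_deriv 1 g) y = (\<Sum>a\<le>m. q1 a * monomial (a, m - a) x)"
    using Suc by metis
  obtain q2 where q2: "\<And>x. dirderiv x m (partial_deriv 2 g) y = (\<Sum>a\<le>m. q2 a * monomial (a, m - a) x)"
    using Suc by metis
  define q where "q a = (if a = 0 then 0 else q1 (a - 1)) + (if a = Suc m then 0 else q2 a)" for a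
  show ?case
  proof (intro exI[of _ q] allI)
    fix x :: "real^2"
    have "(\<Sum>a\<le>Suc m. q a * monomial (a, Suc m - a) x) =
        (\<Sum>a\<le>Suc m. (if a = 0 then 0 else q1 (a - 1)) * monomial (a, Suc m - a) x) +
        (\<Sum>a\<le>Suc m. (if a = Suc m then 0 else q2 a) * monomial (a, Suc m - a) x)"
      by (simp only: q_def distrib_right sum.distrib)
    also have "(\<Sum>a\<le>Suc m. (if a = 0 then 0 else q1 (a - 1)) * monomial (a, Suc m - a) x) =
        (\<Sum>a\<le>m. q1 a * monomial (Suc a, m - a) x)"
      by (subst sum.atMost_Suc_shift) simp
    also have "\<dots> = x $ 1 * dirderiv x m (partial_deriv 1 g) y"
      by (simp add: q1 sum_distrib_left monomial_def mult_ac)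
    also have "(\<Sum>a\<le>Suc m. (if a = Suc m then 0 else q2 a) * monomial (a, Suc m - a) x) =
        (\<Sum>a\<le>m. q2 a * monomial (a, Suc m - a) x)"
      by simp
    also have "\<dots> = x $ 2 * dirderiv x m (partial_deriv 2 g) y"
      by (simp add: q2 sum_distrib_left monomial_def mult_ac Suc_diff_le)
    finally show "dirderiv x (Suc m) g y = (\<Sum>a\<le>Suc m. q a * monomial (a, Suc m - a) x)"
      by (simp add: UNIV_2)
  qed
qed

text \<open>Restriction to a ray reduces the estimate to the one-variable Maclaurin formula; the derivative of order
$k+1$ in its remainder is bounded near the origin because it is continuous there.\<close>

lemma taylor_remainder_along_ray:
  assumes "open U" "0 \<in> U" "C_on (k + 1) u U"
  shows "(\<lambda>h. u (h *\<^sub>R x) - (\<Sum>m\<le>k. dirderiv x m u 0 / fact m * h ^ m)) \<in> O[at_right 0](\<lambda>h. h ^ (k + 1))"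
proof -
  let ?D = "dirderiv x (k + 1) u"
  have "isCont ?D 0"
    using dirderiv_continuous_on[OF assms(3)] assms(1,2) continuous_on_eq_continuous_at by blast
  then have "((\<lambda>t. ?D (t *\<^sub>R x)) \<longlongrightarrow> ?D 0) (at_right 0)"
    by (intro isCont_tendsto_compose[where g = ?D]) (auto intro!: tendsto_eq_intros)
  then have "((\<lambda>t. \<bar>?D (t *\<^sub>R x)\<bar>) \<longlongrightarrow> \<bar>?D 0\<bar>) (at_right 0)" by (rule tendsto_rabs)
  then have ev1: "\<forall>\<^sub>F t in at_right 0. \<bar>?D (t *\<^sub>R x)\<bar> < \<bar>?D 0\<bar> + 1"
    by (rule order_tendstoD) simp
  have "((\<lambda>t. t *\<^sub>R x) \<longlongrightarrow> 0) (at_right 0)" by (auto intro!: tendsto_eq_intros)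
  then have ev2: "\<forall>\<^sub>F t in at_right 0. t *\<^sub>R x \<in> U"
    using assms(1,2) by (rule topological_tendstoD)
  obtain e where e: "e > 0" "\<And>t. 0 < t \<Longrightarrow> t < e \<Longrightarrow> \<bar>?D (t *\<^sub>R x)\<bar> < \<bar>?D 0\<bar> + 1"
    "\<And>t. 0 < t \<Longrightarrow> t < e \<Longrightarrow> t *\<^sub>R x \<in> U"
    using eventually_conj[OF ev1 ev2] unfolding eventually_at_right_field by auto
  have "\<bar>u (h *\<^sub>R x) - (\<Sum>m\<le>k. dirderiv x m u 0 / fact m * h ^ m)\<bar> \<le> (\<bar>?D 0\<bar> + 1) * h ^ (k + 1)"
    if h: "0 < h" "h < e" for h
  proof -
    have inU: "t *\<^sub>R x \<in> U" if "0 \<le> t" "t \<le> h" for t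
      using that h e(3)[of t] assms(2) by (cases "t = 0") auto
    have "\<exists>t. 0 < t \<and> t < h \<and> u (h *\<^sub>R x) =
        (\<Sum>m<k + 1. dirderiv x m u (0 *\<^sub>R x) / fact m * h ^ m) +
        dirderiv x (k + 1) u (t *\<^sub>R x) / fact (k + 1) * h ^ (k + 1)"
    proof (rule Maclaurin[where diff = "\<lambda>m t. dirderiv x m u (t *\<^sub>R x)"])
      show "\<forall>m t. m < k + 1 \<and> 0 \<le> t \<and> t \<le> h \<longrightarrow>
          ((\<lambda>t. dirderiv x m u (t *\<^sub>R x)) has_real_derivative dirderiv x (Suc m) u (t *\<^sub>R x)) (at t)"
      proof (intro allI impI dirderiv_has_derivative_along_line)
        fix m t assume "m < k + 1 \<and> 0 \<le> t \<and> t \<le> h"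
        then show "C_on (Suc m) u U" "t *\<^sub>R x \<in> U"
          using C_on_mono[OF assms(3) _ assms(1), of "Suc m"] inU by auto
      qed
    qed (use h in auto)
    then obtain t where t: "0 < t" "t < h" and eq: "u (h *\<^sub>R x) =
        (\<Sum>m<k + 1. dirderiv x m u 0 / fact m * h ^ m) + ?D (t *\<^sub>R x) / fact (k + 1) * h ^ (k + 1)"
      by (auto simp del: dirderiv.simps)
    have "u (h *\<^sub>R x) - (\<Sum>m\<le>k. dirderiv x m u 0 / fact m * h ^ m) = ?D (t *\<^sub>R x) / fact (k + 1) * h ^ (k + 1)"
      using eq by (simp add: lessThan_Suc_atMost del: dirderiv.simps fact_Suc)
    also have "\<bar>\<dots>\<bar> = \<bar>?D (t *\<^sub>R x)\<bar> / fact (k + 1) * h ^ (k + 1)"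
      using h by (simp add: abs_mult del: dirderiv.simps fact_Suc)
    also have "\<dots> \<le> \<bar>?D (t *\<^sub>R x)\<bar> * h ^ (k + 1)"
      using h divide_left_mono[of 1 "fact (k + 1)" "\<bar>?D (t *\<^sub>R x)\<bar>"]
      by (intro mult_right_mono) (auto simp del: dirderiv.simps fact_Suc simp: fact_ge_1)
    also have "\<dots> \<le> (\<bar>?D 0\<bar> + 1) * h ^ (k + 1)"
      using e(2)[of t] t h by (intro mult_right_mono) (auto simp del: dirderiv.simps)
    finally show ?thesis .
  qed
  then have "\<forall>\<^sub>F h in at_right 0. norm (u (h *\<^sub>R x) - (\<Sum>m\<le>k. dirderiv x m u 0 / fact m * h ^ m))
      \<le> (\<bar>?D 0\<bar> + 1) * norm (h ^ (k + 1))"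
    unfolding eventually_at_right_field using e(1) by (intro exI[of _ e]) auto
  then show ?thesis by (rule bigoI)
qed

section \<open>Rules that reproduce the Laplacian of monomials\<close>

lemma partial_deriv_monomial:
  "partial_deriv i (monomial (a, b)) =
     (if i = 1 then (\<lambda>x. a * monomial (a - 1, b) x) else (\<lambda>x. b * monomial (a, b - 1) x))"
proof (rule ext)
  fix x :: "real^2"
  have ax: "axis j 1 $ i = (if i = j then 1 else (0::real))" for i j :: 2
    by (auto simp: axis_def)
  have "((\<lambda>t. monomial (a, b) (x + t *\<^sub>R axis i 1)) has_real_derivative
     (if i = 1 then a * monomial (a - 1, b) x else b * monomial (a, b - 1) x)) (at 0)"
    using exhaust_2[of i] by (auto simp: monomial_def ax intro!: derivative_eq_intros)
  then show "partial_deriv i (monomial (a, b)) x = (if i = 1 then (\<lambda>x. a * monomial (a - 1, b) x) else (\<lambda>x. b * monomial (a, b - 1) x)) x"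
    by (simp add: partial_deriv_def DERIV_imp_deriv split: if_splits)
qed

lemma partial_deriv_cmult_monomial:
  "partial_deriv i (\<lambda>x. r * monomial e x) x = r * partial_deriv i (monomial e) x"
proof -
  have "(\<lambda>t. monomial e (x + t *\<^sub>R axis i 1)) field_differentiable (at 0)"
    unfolding monomial_def by (auto simp: axis_def intro!: derivative_intros)
  then show ?thesis by (simp add: partial_deriv_def deriv_cmult)
qed

lemma laplacian_monomial_0:
  "laplacian (monomial (a, b)) 0 = (if (a, b) \<in> {(2, 0), (0, 2)} then 2 else 0)"
proof -
  have second: "real n * real (n - 1) * 0 ^ (n - 1 - 1) = (if n = 2 then 2 else 0)" for n :: nat
    by (cases "n = 2") (auto simp: power_0_left)
  have "laplacian (monomial (a, b)) 0 = (real a * real (a - 1) * 0 ^ (a - 1 - 1)) * 0 ^ b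
      + (real b * real (b - 1) * 0 ^ (b - 1 - 1)) * 0 ^ a"
    by (simp add: laplacian_def UNIV_2 partial_deriv_monomial partial_deriv_cmult_monomial
          del: diff_diff_left) (simp add: monomial_def)
  also have "\<dots> = (if a = 2 then 2 else 0) * 0 ^ b + (if b = 2 then 2 else 0) * 0 ^ a"
    unfolding second ..
  finally show ?thesis by (simp add: power_0_left)
qed

lemma dirderiv_scaleR: "dirderiv (h *\<^sub>R x) m g y = h ^ m * dirderiv x m g y"
  by (induction m arbitrary: g) (simp_all add: sum_distrib_left mult_ac)

text \<open>The Laplacian at the origin kills every homogeneous polynomial except a quadratic form, and of that
it sees only the two pure squares. Their coefficients in the second-order Taylor term are the values
of that term at the unit vectors, that is the pure second partials, whence the factor 2 once the
factorial is left out.\<close>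

lemma laplacian_exact_quadrature_dirderiv:
  fixes W :: "'i \<Rightarrow> real" and X :: "'i \<Rightarrow> real^2"
  assumes exact: "\<And>a b. a + b = m \<Longrightarrow>
    (\<Sum>i\<in>I. W i * monomial (a, b) (X i)) = laplacian (monomial (a, b)) 0"
  shows "(\<Sum>i\<in>I. W i * dirderiv (X i) m g y) = (if m = 2 then 2 * laplacian g y else 0)"
proof -
  obtain q where q: "\<And>x. dirderiv x m g y = (\<Sum>a\<le>m. q a * monomial (a, m - a) x)"
    using dirderiv_homogeneous_polynomial[of m g y] by blast
  have "(\<Sum>i\<in>I. W i * dirderiv (X i) m g y) =
      (\<Sum>a\<le>m. q a * (\<Sum>i\<in>I. W i * monomial (a, m - a) (X i)))"
    unfolding q sum_distrib_left by (subst sum.swap) (simp add: mult_ac)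
  also have "\<dots> = (\<Sum>a\<le>m. q a * laplacian (monomial (a, m - a)) 0)"
    by (intro sum.cong) (simp_all add: exact)
  also have "\<dots> = (if m = 2 then 2 * laplacian g y else 0)"
  proof (cases "m = 2")
    case True
    have ax: "axis j 1 $ i = (if i = j then 1 else (0::real))" for i j :: 2
      by (auto simp: axis_def)
    have "{..2::nat} = {0, 1, 2}" by auto
    (* evaluating the quadratic form at the unit vectors isolates the coefficients of the squares *)
    then have "dirderiv (axis 1 1) 2 g y = q 2" "dirderiv (axis 2 1) 2 g y = q 0"
      using q[of "axis 1 1"] q[of "axis 2 1"] True
      by (simp_all add: monomial_def ax power_0_left del: dirderiv.simps)
    then have "laplacian g y = q 2 + q 0"
      by (simp add: laplacian_def UNIV_2 numeral_2_eq_2 ax)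
    then show ?thesis
      using True \<open>{..2::nat} = {0, 1, 2}\<close> by (simp add: laplacian_monomial_0)
  next
    case False
    then have "laplacian (monomial (a, m - a)) 0 = 0" if "a \<le> m" for a
      using that by (auto simp: laplacian_monomial_0)
    then show ?thesis using False by simp
  qed
  finally show ?thesis .
qed

text \<open>For $k=1$ the rule returns 0 and not the Laplacian, since no quadratic monomial is reproduced.\<close>

lemma laplacian_exact_quadrature_taylor:
  fixes W :: "'i \<Rightarrow> real" and X :: "'i \<Rightarrow> real^2"
  assumes exact: "\<And>a b. 1 \<le> a + b \<Longrightarrow> a + b \<le> k \<Longrightarrow>
    (\<Sum>i\<in>I. W i * monomial (a, b) (h *\<^sub>R X i)) = laplacian (monomial (a, b)) 0"
  shows "(\<Sum>i\<in>I. W i * ((\<Sum>m\<le>k. dirderiv (X i) m u 0 / fact m * h ^ m) - u 0)) =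
    (if k \<ge> 2 then laplacian u 0 else 0)"
proof -
  have "(\<Sum>m\<le>k. dirderiv x m u 0 / fact m * h ^ m) - u 0 =
      (\<Sum>m=1..k. dirderiv (h *\<^sub>R x) m u 0 / fact m)" for x
    by (simp add: dirderiv_scaleR atMost_atLeast0 sum.atLeast_Suc_atMost[of 0] mult.commute)
  then have "(\<Sum>i\<in>I. W i * ((\<Sum>m\<le>k. dirderiv (X i) m u 0 / fact m * h ^ m) - u 0)) =
      (\<Sum>m=1..k. (\<Sum>i\<in>I. W i * dirderiv (h *\<^sub>R X i) m u 0) / fact m)"
    unfolding sum_divide_distrib by (subst sum.swap) (simp add: sum_distrib_left)
  also have "\<dots> = (\<Sum>m=1..k. if m = 2 then laplacian u 0 else 0)"
  proof (intro sum.cong refl)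
    fix m assume m: "m \<in> {1..k}"
    then have "(\<Sum>i\<in>I. W i * dirderiv (h *\<^sub>R X i) m u 0) = (if m = 2 then 2 * laplacian u 0 else 0)"
      by (intro laplacian_exact_quadrature_dirderiv exact) auto
    then show "(\<Sum>i\<in>I. W i * dirderiv (h *\<^sub>R X i) m u 0) / fact m = (if m = 2 then laplacian u 0 else 0)"
      by (simp add: fact_2)
  qed
  also have "\<dots> = (if k \<ge> 2 then laplacian u 0 else 0)"
    by (simp add: sum.delta)
  finally show ?thesis .
qed

section \<open>Laplacians of radial functions\<close>

lemma norm_power2_vec2: "(norm (x :: real^2))\<^sup>2 = (x $ 1)\<^sup>2 + (x $ 2)\<^sup>2"
  by (simp add: norm_vec_def L2_set_def UNIV_2)

text \<open>The argument of $f$ never leaves $[0,\infty)$, so the chain rule holds with derivatives of $f$ within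
that interval, even at the centre $p$, where only the one-sided derivative of $f$ exists.\<close>

lemma partial_deriv_radial:
  fixes x p :: "real^2"
  assumes c: "c \<ge> 0"
    and f: "\<And>t. t \<ge> 0 \<Longrightarrow> (f has_real_derivative f' t) (at t within {0..})"
  shows "((\<lambda>t. f (c * (norm (x + t *\<^sub>R axis i 1 - p))\<^sup>2)) has_real_derivative
      f' (c * (norm (x - p))\<^sup>2) * (2 * c * (x - p) $ i)) (at 0)"
proof -
  let ?g = "\<lambda>t. c * (norm (x + t *\<^sub>R axis i 1 - p))\<^sup>2"
  have ax: "axis j 1 $ i = (if i = j then 1 else (0::real))" for i j :: 2
    by (auto simp: axis_def)
  have g: "(?g has_real_derivative 2 * c * (x - p) $ i) (at 0)"
    unfolding norm_power2_vec2 using exhaust_2[of i]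
    by (auto simp: ax intro!: derivative_eq_intros)
  have "(f has_real_derivative f' (?g 0)) (at (?g 0) within range ?g)"
    by (rule has_field_derivative_subset[OF f]) (use c in auto)
  from DERIV_image_chain[OF this g] show ?thesis by (simp add: o_def)
qed

lemma laplacian_radial:
  fixes x p :: "real^2"
  assumes c: "c \<ge> 0"
    and f: "\<And>t. t \<ge> 0 \<Longrightarrow> (f has_real_derivative f' t) (at t within {0..})"
    and f': "\<And>t. t \<ge> 0 \<Longrightarrow> (f' has_real_derivative f'' t) (at t within {0..})"
  shows "laplacian (\<lambda>x. f (c * (norm (x - p))\<^sup>2) - q) x =
    4 * c * (c * (norm (x - p))\<^sup>2 * f'' (c * (norm (x - p))\<^sup>2) + f' (c * (norm (x - p))\<^sup>2))"
proof -
  let ?t = "c * (norm (x - p))\<^sup>2"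
  have 1: "partial_deriv i (\<lambda>x. f (c * (norm (x - p))\<^sup>2) - q) =
      (\<lambda>x. f' (c * (norm (x - p))\<^sup>2) * (2 * c * (x - p) $ i))" for i
    unfolding partial_deriv_def
    by (intro ext DERIV_imp_deriv)
       (use DERIV_diff[OF partial_deriv_radial[OF c f] DERIV_const] in simp)
  have 2: "partial_deriv i (\<lambda>x. f' (c * (norm (x - p))\<^sup>2) * (2 * c * (x - p) $ i)) x =
      f'' ?t * (2 * c * (x - p) $ i) * (2 * c * (x - p) $ i) + 2 * c * f' ?t" for i
  proof -
    have "((\<lambda>t. 2 * c * (x + t *\<^sub>R axis i 1 - p) $ i) has_real_derivative 2 * c) (at 0)"
      by (auto simp: axis_def intro!: derivative_eq_intros)
    from DERIV_mult[OF partial_deriv_radial[OF c f'] this] show ?thesis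
      unfolding partial_deriv_def by (intro DERIV_imp_deriv) simp
  qed
  have "laplacian (\<lambda>x. f (c * (norm (x - p))\<^sup>2) - q) x =
      4 * c * (c * (((x - p) $ 1)\<^sup>2 + ((x - p) $ 2)\<^sup>2) * f'' ?t + f' ?t)"
    unfolding laplacian_def 1 2 UNIV_2 by (simp add: power2_eq_square algebra_simps)
  then show ?thesis unfolding norm_power2_vec2[of "x - p"] .
qed

text \<open>Up to the factor $4c$, the value depends on $c$ and $h$ only through $ch^2$; this is what makes the
right-hand side of the system scale like $h^{-2}$.\<close>

lemma laplacian_psi_0:
  assumes h: "h > 0" and c: "c > 0"
    and \<phi>: "\<And>r s. r \<ge> 0 \<Longrightarrow> s > 0 \<Longrightarrow> \<phi> r s = f (s * r\<^sup>2)"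
    and f: "\<And>t. t \<ge> 0 \<Longrightarrow> (f has_real_derivative f' t) (at t within {0..})"
    and f': "\<And>t. t \<ge> 0 \<Longrightarrow> (f' has_real_derivative f'' t) (at t within {0..})"
  shows "laplacian (psi \<phi> c h gs m) 0 =
    4 * c * (c * h\<^sup>2 * (norm (gs m))\<^sup>2 * f'' (c * h\<^sup>2 * (norm (gs m))\<^sup>2) + f' (c * h\<^sup>2 * (norm (gs m))\<^sup>2))"
proof -
  have "psi \<phi> c h gs m = (\<lambda>x. f (c * (norm (x - h *\<^sub>R gs m))\<^sup>2) - \<phi> (norm (h *\<^sub>R gs m)) c)"
    using c by (intro ext) (simp add: psi_def \<phi>)
  then show ?thesis
    using c h laplacian_radial[OF _ f f', of c "h *\<^sub>R gs m" _ 0] by (simp add: power_mult_distrib mult.assoc)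
qed

section \<open>Scaling of the system\<close>

text \<open>The diagonal matrices that relate the system at scale $h$ to the one at scale 1: a basis polynomial
of degree $q$ contributes $h^q$, while a sample point (for rows, \<open>p = n\<close>) or a ghost point
(for columns, \<open>p = d\<close>) contributes 1.\<close>

definition block_scale :: "nat \<Rightarrow> (nat \<Rightarrow> nat \<times> nat) \<Rightarrow> real \<Rightarrow> nat \<Rightarrow> real" where
  "block_scale p E h i = (if i < p then 1 else h ^ (fst (E (i - p)) + snd (E (i - p))))"

lemma block_scale_pos: "h > 0 \<Longrightarrow> block_scale p E h i > 0"
  by (simp add: block_scale_def)

lemma cls_gsp_matrix_carrier:
  "cls_gsp_matrix \<phi> k E n xs d gs c h \<in> carrier_mat (n + num_monomials k) (d + num_monomials k)"
  by (simp add: cls_gsp_matrix_def Let_def)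

lemma cls_gsp_rhs_carrier: "cls_gsp_rhs \<phi> k E d gs c h \<in> carrier_vec (d + num_monomials k)"
  by (simp add: cls_gsp_rhs_def)

lemma monomial_scaleR: "monomial e (h *\<^sub>R x) = h ^ (fst e + snd e) * monomial e x"
  by (simp add: monomial_def power_mult_distrib power_add)

text \<open>The radial block does not change at all, because $c\|hx-h\hat x\|^2=ch^2\|x-\hat x\|^2$; the polynomial
blocks change by the homogeneity of monomials.\<close>

lemma cls_gsp_matrix_scaling:
  assumes h: "h > 0" and c: "c > 0" "c * h\<^sup>2 = \<kappa>"
    and \<phi>: "\<And>r s. r \<ge> 0 \<Longrightarrow> s > 0 \<Longrightarrow> \<phi> r s = f (s * r\<^sup>2)"
    and i: "i < n + num_monomials k" and r: "r < d + num_monomials k"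
  shows "cls_gsp_matrix \<phi> k E n xs d gs c h $$ (i, r) =
    block_scale n E h i * cls_gsp_matrix \<phi> k E n xs d gs \<kappa> 1 $$ (i, r) * block_scale d E h r"
proof -
  have \<kappa>: "\<kappa> > 0" using h c by auto
  have "psi \<phi> c h gs m (h *\<^sub>R x) = psi \<phi> \<kappa> 1 gs m x" for m x
  proof -
    have "norm (h *\<^sub>R x - h *\<^sub>R gs m) = h * norm (x - gs m)"
      using h by (simp flip: scaleR_diff_right)
    then show ?thesis
      using h c \<kappa> by (simp add: psi_def \<phi> power_mult_distrib flip: mult.assoc)
  qed
  then show ?thesis
    using i r by (auto simp: cls_gsp_matrix_def Let_def block_scale_def monomial_scaleR[of _ h])
qed

text \<open>In the polynomial part the factor $h^{q-2}$ for degree $q$ is correct because the Laplacian at the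
origin vanishes unless $q=2$.\<close>

lemma cls_gsp_rhs_scaling:
  assumes h: "h > 0" and c: "c > 0" "c * h\<^sup>2 = \<kappa>"
    and \<phi>: "\<And>r s. r \<ge> 0 \<Longrightarrow> s > 0 \<Longrightarrow> \<phi> r s = f (s * r\<^sup>2)" and f: "C2_nonneg f"
    and r: "r < d + num_monomials k"
  shows "vec_index (cls_gsp_rhs \<phi> k E d gs c h) r =
    block_scale d E h r * vec_index (cls_gsp_rhs \<phi> k E d gs \<kappa> 1) r / h\<^sup>2"
proof (cases "r < d")
  case True
  obtain f' f'' where f': "\<And>t. t \<ge> 0 \<Longrightarrow> (f has_real_derivative f' t) (at t within {0..})"
    "\<And>t. t \<ge> 0 \<Longrightarrow> (f' has_real_derivative f'' t) (at t within {0..})"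
    using f unfolding C2_nonneg_def by blast
  have \<kappa>: "\<kappa> > 0" using h c by auto
  have c': "c = \<kappa> / h\<^sup>2" using c h by (simp add: field_simps)
  define g where "g = \<kappa> * (norm (gs r))\<^sup>2"
  have lap: "laplacian (psi \<phi> s t gs r) 0 = 4 * s * (g * f'' g + f' g)"
    if "t > 0" "s > 0" "s * t\<^sup>2 = \<kappa>" for s t
    using laplacian_psi_0[OF that(1,2) \<phi> f'] that(3) by (simp add: g_def)
  have "laplacian (psi \<phi> c h gs r) 0 = laplacian (psi \<phi> \<kappa> 1 gs r) 0 / h\<^sup>2"
    using lap[OF h c] lap[of 1 \<kappa>] \<kappa> by (simp add: c')
  then show ?thesis using True by (simp add: cls_gsp_rhs_def block_scale_def)
next
  case False
  obtain a b where ab: "E (r - d) = (a, b)" by fastforce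
  show ?thesis
    using False r h by (auto simp: cls_gsp_rhs_def block_scale_def ab laplacian_monomial_0 power2_eq_square)
qed

section \<open>Properties of the weights\<close>

lemma cls_gsp_weights_nth:
  assumes "i < n"
  shows "vec_index (cls_gsp_weights \<phi> k E n xs d gs c h) i =
    vec_index (pinv ((cls_gsp_matrix \<phi> k E n xs d gs c h)\<^sup>T) *\<^sub>v cls_gsp_rhs \<phi> k E d gs c h) i"
  using assms by (simp add: cls_gsp_weights_def vec_first_def)

text \<open>The second block of equations in $M_h^Tw=b$ says precisely this, as the zero block removes $w_B$.\<close>

lemma cls_gsp_weights_exact_on_monomials:
  assumes E: "bij_betw E {..<num_monomials k} (exponents k)"
    and rank: "vec_space.rank (n + num_monomials k) (cls_gsp_matrix \<phi> k E n xs d gs c h) = d + num_monomials k"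
    and ab: "1 \<le> a + b" "a + b \<le> k"
  shows "(\<Sum>i<n. vec_index (cls_gsp_weights \<phi> k E n xs d gs c h) i * monomial (a, b) (h *\<^sub>R xs i))
    = laplacian (monomial (a, b)) 0"
proof -
  let ?l = "num_monomials k" and ?M = "cls_gsp_matrix \<phi> k E n xs d gs c h"
  let ?b = "cls_gsp_rhs \<phi> k E d gs c h"
  let ?w = "pinv (?M\<^sup>T) *\<^sub>v ?b"
  obtain j where j: "j < ?l" "E j = (a, b)"
    using E ab unfolding bij_betw_def exponents_def by (force simp: image_iff set_eq_iff)
  have "(\<Sum>i<n + ?l. ?M $$ (i, d + j) * vec_index ?w i) = vec_index ?b (d + j)"
    by (rule pinv_transpose_solves(2)[OF cls_gsp_matrix_carrier rank cls_gsp_rhs_carrier])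
       (use j in simp)
  also have "vec_index ?b (d + j) = laplacian (monomial (a, b)) 0"
    using j by (simp add: cls_gsp_rhs_def)
  finally have eq: "(\<Sum>i<n + ?l. ?M $$ (i, d + j) * vec_index ?w i) = laplacian (monomial (a, b)) 0" .
  have "(\<Sum>i<n + ?l. ?M $$ (i, d + j) * vec_index ?w i) = (\<Sum>i<n. ?M $$ (i, d + j) * vec_index ?w i)"
    using j by (intro sum.mono_neutral_right) (auto simp: cls_gsp_matrix_def Let_def)
  also have "\<dots> = (\<Sum>i<n. vec_index (cls_gsp_weights \<phi> k E n xs d gs c h) i * monomial (a, b) (h *\<^sub>R xs i))"
    using j by (intro sum.cong) (auto simp: cls_gsp_weights_nth cls_gsp_matrix_def Let_def)
  finally show ?thesis using eq by simp
qed

text \<open>With $M_h=S_hM_1T_h$ and $b_h=h^{-2}T_hb_1$ for the diagonal scalings $S_h,T_h$, the vector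
$x=h^2S_hw$ solves the fixed system $M_1^Tx=b_1$. The minimal norm of $w$ turns into minimality of
$x$ in the Euclidean norm weighted by the diagonal of $S_h^{-2}$ (up to a common factor). These weights
degenerate as $h\to 0$, with different powers of $h$ for different degrees, which is why a bound
uniform in the weights is needed. On the first $n$ coordinates $S_h$ is the identity, so a bound on
$x$ is one on $h^2w_A$.\<close>

lemma cls_gsp_weights_bound:
  assumes f: "C2_nonneg f"
    and \<phi>: "\<And>r s. r \<ge> 0 \<Longrightarrow> s > 0 \<Longrightarrow> \<phi> r s = f (s * r\<^sup>2)"
    and c: "\<And>h. h > 0 \<Longrightarrow> c h > 0" "\<And>h. h > 0 \<Longrightarrow> c h * h\<^sup>2 = \<kappa>"
    and rank: "\<And>h. h > 0 \<Longrightarrow>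
      vec_space.rank (n + num_monomials k) (cls_gsp_matrix \<phi> k E n xs d gs (c h) h) = d + num_monomials k"
  obtains C where "\<And>h i. h > 0 \<Longrightarrow> i < n \<Longrightarrow>
    \<bar>vec_index (cls_gsp_weights \<phi> k E n xs d gs (c h) h) i\<bar> \<le> C / h\<^sup>2"
proof -
  let ?l = "num_monomials k"
  define M where "M h = cls_gsp_matrix \<phi> k E n xs d gs (c h) h" for h
  define b where "b h = cls_gsp_rhs \<phi> k E d gs (c h) h" for h
  define w where "w h = pinv ((M h)\<^sup>T) *\<^sub>v b h" for h
  define M1 where "M1 = cls_gsp_matrix \<phi> k E n xs d gs \<kappa> 1"
  define b1 where "b1 = cls_gsp_rhs \<phi> k E d gs \<kappa> 1"
  let ?\<sigma> = "block_scale n E" and ?\<tau> = "block_scale d E"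
  define x where "x h i = h\<^sup>2 * ?\<sigma> h i * vec_index (w h) i" for h i
  have scaleM: "M h $$ (i, r) = ?\<sigma> h i * M1 $$ (i, r) * ?\<tau> h r"
    if "h > 0" "i < n + ?l" "r < d + ?l" for h i r
    unfolding M_def M1_def using cls_gsp_matrix_scaling[where \<phi> = \<phi> and f = f, OF that(1) c[OF that(1)] \<phi> that(2,3)] .
  have scaleb: "vec_index (b h) r = ?\<tau> h r * vec_index b1 r / h\<^sup>2" if "h > 0" "r < d + ?l" for h r
    unfolding b_def b1_def using cls_gsp_rhs_scaling[where \<phi> = \<phi> and f = f, OF that(1) c[OF that(1)] \<phi> f that(2)] .
  have solves: "(\<Sum>i<n + ?l. M h $$ (i, r) * vec_index (w h) i) = vec_index (b h) r"
    if "h > 0" "r < d + ?l" for h r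
    unfolding M_def b_def w_def
    by (rule pinv_transpose_solves(2)[OF cls_gsp_matrix_carrier rank cls_gsp_rhs_carrier]) (use that in auto)
  have orthogonal: "(\<Sum>i<n + ?l. vec_index (w h) i * z i) = 0"
    if "h > 0" "\<And>r. r < d + ?l \<Longrightarrow> (\<Sum>i<n + ?l. M h $$ (i, r) * z i) = 0" for h z
    using that(2) unfolding M_def b_def w_def
    by (rule pinv_transpose_solves(3)[OF cls_gsp_matrix_carrier rank[OF that(1)] cls_gsp_rhs_carrier])
  obtain C where C: "\<And>x i. (\<forall>r\<in>{..<d + ?l}. (\<Sum>i<n + ?l. M1 $$ (i, r) * x i) = vec_index b1 r) \<Longrightarrow>
      weighted_orthogonal {..<n + ?l} {..<d + ?l} (\<lambda>r i. M1 $$ (i, r)) x \<Longrightarrow> i < n + ?l \<Longrightarrow> \<bar>x i\<bar> \<le> C"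
    using weighted_orthogonal_solutions_bounded[OF finite_lessThan[of "n + ?l"],
        of "{..<d + ?l}" "\<lambda>r i. M1 $$ (i, r)" "vec_index b1"] by blast
  have xC: "\<bar>x h i\<bar> \<le> C" if h: "h > 0" and i: "i < n + ?l" for h i
  proof (rule C[OF _ _ i])
    show "\<forall>r\<in>{..<d + ?l}. (\<Sum>i<n + ?l. M1 $$ (i, r) * x h i) = vec_index b1 r"
    proof
      fix r assume r: "r \<in> {..<d + ?l}"
      have \<tau>: "?\<tau> h r > 0" by (rule block_scale_pos[OF h])
      have "?\<tau> h r * (\<Sum>i<n + ?l. M1 $$ (i, r) * x h i) = h\<^sup>2 * (\<Sum>i<n + ?l. M h $$ (i, r) * vec_index (w h) i)"
        unfolding sum_distrib_left
        by (intro sum.cong) (use r h in \<open>simp_all add: scaleM x_def mult_ac\<close>)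
      also have "\<dots> = ?\<tau> h r * vec_index b1 r"
        using solves[OF h, of r] r h by (simp add: scaleb)
      finally show "(\<Sum>i<n + ?l. M1 $$ (i, r) * x h i) = vec_index b1 r" using \<tau> by simp
    qed
    show "weighted_orthogonal {..<n + ?l} {..<d + ?l} (\<lambda>r i. M1 $$ (i, r)) (x h)"
      unfolding weighted_orthogonal_def
    proof (intro exI[of _ "\<lambda>i. 1 / (h * ?\<sigma> h i)\<^sup>2"] conjI ballI allI impI)
      show "1 / (h * ?\<sigma> h i)\<^sup>2 > 0" for i
        using h block_scale_pos[OF h, of n E i] by simp
      fix z :: "nat \<Rightarrow> real"
      assume z: "\<forall>r\<in>{..<d + ?l}. (\<Sum>i<n + ?l. M1 $$ (i, r) * z i) = 0"
      have \<sigma>: "?\<sigma> h i \<noteq> 0" for i using block_scale_pos[OF h, of n E i] by simp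
      have "(\<Sum>i<n + ?l. M h $$ (i, r) * (z i / ?\<sigma> h i)) = 0" if r: "r < d + ?l" for r
      proof -
        have "(\<Sum>i<n + ?l. M h $$ (i, r) * (z i / ?\<sigma> h i)) = ?\<tau> h r * (\<Sum>i<n + ?l. M1 $$ (i, r) * z i)"
          unfolding sum_distrib_left
          by (intro sum.cong) (use r h \<sigma> in \<open>simp_all add: scaleM\<close>)
        then show ?thesis using z r by simp
      qed
      then have "(\<Sum>i<n + ?l. vec_index (w h) i * (z i / ?\<sigma> h i)) = 0"
        by (rule orthogonal[OF h])
      moreover have "1 / (h * ?\<sigma> h i)\<^sup>2 * (x h i * z i) = vec_index (w h) i * (z i / ?\<sigma> h i)" for i
        using h \<sigma>[of i] by (simp add: x_def field_simps power2_eq_square)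
      ultimately show "(\<Sum>i<n + ?l. 1 / (h * ?\<sigma> h i)\<^sup>2 * (x h i * z i)) = 0" by simp
    qed
  qed
  show thesis
  proof (rule that[of C])
    fix h :: real and i assume h: "h > 0" and i: "i < n"
    have "vec_index (cls_gsp_weights \<phi> k E n xs d gs (c h) h) i = x h i / h\<^sup>2"
      using h i by (simp add: cls_gsp_weights_nth x_def w_def M_def b_def block_scale_def)
    then show "\<bar>vec_index (cls_gsp_weights \<phi> k E n xs d gs (c h) h) i\<bar> \<le> C / h\<^sup>2"
      using xC[OF h, of i] i by (simp add: abs_divide divide_right_mono)
  qed
qed

section \<open>Consistency\<close>

theorem theorem1:
  fixes k n d :: nat
    and u :: "real^2 \<Rightarrow> real" and U :: "(real^2) set"
    and \<phi> :: "real \<Rightarrow> real \<Rightarrow> real" and f :: "real \<Rightarrow> real"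
    and xs gs :: "nat \<Rightarrow> real^2"
    and c :: "real \<Rightarrow> real" and \<kappa> :: real
    and E :: "nat \<Rightarrow> nat \<times> nat"
  assumes "k \<ge> 1"
    and "open U" and "0 \<in> U" and "C_on (k + 1) u U"
    and "C2_nonneg f"
    and "\<And>r s. r \<ge> 0 \<Longrightarrow> s > 0 \<Longrightarrow> \<phi> r s = f (s * r\<^sup>2)"
    and "d < n"
    and "\<And>h. h > 0 \<Longrightarrow> c h > 0"
    and "\<And>h. h > 0 \<Longrightarrow> c h * h\<^sup>2 = \<kappa>"
    and "bij_betw E {..<num_monomials k} (exponents k)"
    and "\<And>h. h > 0 \<Longrightarrow>
      vec_space.rank (n + num_monomials k) (cls_gsp_matrix \<phi> k E n xs d gs (c h) h)
        = d + num_monomials k"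
  shows "(\<lambda>h. \<bar>cls_gsp_weights \<phi> k E n xs d gs (c h) h \<bullet> vec n (\<lambda>i. u (h *\<^sub>R xs i) - u 0)
               - laplacian u 0\<bar>) \<in> O[at_right 0](\<lambda>h. h ^ (k - 1))"
proof -
  define W where "W h i = vec_index (cls_gsp_weights \<phi> k E n xs d gs (c h) h) i" for h i
  define T where "T h i = (\<Sum>m\<le>k. dirderiv (xs i) m u 0 / fact m * h ^ m)" for h i
  (* For k = 1 the rule misses the Laplacian entirely; this constant error is still O(h^0). *)
  define \<epsilon> where "\<epsilon> = (if k \<ge> 2 then 0 else - laplacian u 0)"
  obtain C where C: "\<And>h i. h > 0 \<Longrightarrow> i < n \<Longrightarrow> \<bar>W h i\<bar> \<le> C / h\<^sup>2"
    unfolding W_def using cls_gsp_weights_bound[OF assms(5,6,8,9,11)] by blast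
  have W: "(\<lambda>h. W h i) \<in> O[at_right 0](\<lambda>h. 1 / h\<^sup>2)" if "i < n" for i
  proof (rule bigoI)
    show "\<forall>\<^sub>F h in at_right 0. norm (W h i) \<le> C * norm (1 / h\<^sup>2)"
      using eventually_at_right_less[of "0::real"] by eventually_elim (use C that in simp)
  qed
  have "(\<lambda>h. W h i * (u (h *\<^sub>R xs i) - T h i)) \<in> O[at_right 0](\<lambda>h. h ^ (k - 1))" if "i < n" for i
  proof -
    have "(\<lambda>h. W h i * (u (h *\<^sub>R xs i) - T h i)) \<in> O[at_right 0](\<lambda>h. 1 / h\<^sup>2 * h ^ (k + 1))"
      unfolding T_def by (intro landau_o.big.mult W that taylor_remainder_along_ray[OF assms(2-4)])
    also have "O[at_right 0](\<lambda>h. 1 / h\<^sup>2 * h ^ (k + 1)) = O[at_right 0](\<lambda>h::real. h ^ (k - 1))"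
    proof (rule landau_o.big.cong)
      show "\<forall>\<^sub>F h in at_right 0. 1 / h\<^sup>2 * h ^ (k + 1) = (h::real) ^ (k - 1)"
        using eventually_at_right_less[of "0::real"]
      proof eventually_elim
        case (elim h)
        have "k + 1 = (k - 1) + 2" using assms(1) by simp
        then have "h ^ (k + 1) = h ^ (k - 1) * h\<^sup>2" by (metis power_add)
        then show ?case using elim by simp
      qed
    qed
    finally show ?thesis .
  qed
  then have remainder: "(\<lambda>h. \<Sum>i<n. W h i * (u (h *\<^sub>R xs i) - T h i)) \<in> O[at_right 0](\<lambda>h. h ^ (k - 1))"
    by (intro big_sum_in_bigo) auto
  have "(\<lambda>h. \<epsilon>) \<in> O[at_right 0](\<lambda>h. h ^ (k - 1))"
  proof (cases "k \<ge> 2")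
    case False
    then have "k = 1" using assms(1) by simp
    then show ?thesis by simp
  qed (simp add: \<epsilon>_def)
  then have "(\<lambda>h. (\<Sum>i<n. W h i * (u (h *\<^sub>R xs i) - T h i)) + \<epsilon>) \<in> O[at_right 0](\<lambda>h. h ^ (k - 1))"
    using remainder by (rule sum_in_bigo(1)[rotated])
  moreover have "\<forall>\<^sub>F h in at_right 0.
      cls_gsp_weights \<phi> k E n xs d gs (c h) h \<bullet> vec n (\<lambda>i. u (h *\<^sub>R xs i) - u 0) - laplacian u 0 =
      (\<Sum>i<n. W h i * (u (h *\<^sub>R xs i) - T h i)) + \<epsilon>"
    using eventually_at_right_less[of "0::real"]
  proof eventually_elim
    case (elim h)
    have taylor: "(\<Sum>i<n. W h i * (T h i - u 0)) = (if k \<ge> 2 then laplacian u 0 else 0)"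
      unfolding T_def W_def
      by (intro laplacian_exact_quadrature_taylor cls_gsp_weights_exact_on_monomials assms elim)
    have "cls_gsp_weights \<phi> k E n xs d gs (c h) h \<bullet> vec n (\<lambda>i. u (h *\<^sub>R xs i) - u 0) =
        (\<Sum>i<n. W h i * (u (h *\<^sub>R xs i) - u 0))"
      by (simp add: scalar_prod_def W_def atLeast0LessThan)
    also have "\<dots> = (\<Sum>i<n. W h i * (u (h *\<^sub>R xs i) - T h i)) + (\<Sum>i<n. W h i * (T h i - u 0))"
      by (simp add: algebra_simps flip: sum.distrib)
    finally show ?case unfolding taylor by (simp add: \<epsilon>_def)
  qed
  ultimately show ?thesis
    by (subst landau_o.big.abs_in_iff) (subst landau_o.big.in_cong, assumption+)
qed

end
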